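(* Let $W$ be chosen so that $P$ satisfies the weak approximation property (WAP) with respect to $A^*A$, with constant $C_P$, and set $C_W = \sqrt{C_P(1+\|W\|^2)}$. Then $Z$ can be chosen to approximate $-A_{cf}A_{ff}^{-1}$ and $\Delta_F$ can be chosen to approximate $A_{ff}^{-1}$ so that $C_W\|\delta_R\|<\|A\|$ and $$\|G\| \leq \| \delta_F \| + \big(1+\|\delta_F\|\big) \frac{C_W\|\delta_R\|}{\|A\|-C_W\|\delta_R\|} = \rho < 1 .$$
   Context: All norms are Euclidean ($\ell^2$) vector norms and induced operator norms; $^*$ denotes the adjoint (transpose). Let $A\in\mathbb{R}^{n\times n}$ be nonsingular. The $n$ unknowns are partitioned into $n_f$ F-points and $n_c$ C-points, $n=n_f+n_c$, ordered with F-points first, and $$A = \begin{bmatrix} A_{ff} & A_{fc} \\ A_{cf} & A_{cc}\end{bmatrix},\qquad P = \begin{bmatrix} W \\ I\end{bmatrix},\qquad R = \begin{bmatrix} Z & I\end{bmatrix},$$ with $A_{ff}$ nonsingular, $W\in\mathbb{R}^{n_f\times n_c}$ and $Z\in\mathbb{R}^{n_c\times n_f}$. The coarse-grid operator is $\mathcal{K} = RAP = ZA_{ff}W + A_{cf}W + ZA_{fc}+A_{cc}$, and $\Delta_F\in\mathbb{R}^{n_f\times n_f}$ is an approximation to $A_{ff}^{-1}$. Admissible choices of $Z$ and $\Delta_F$ are those with $\mathcal{K}$ and $\Delta_F$ nonsingular. The accuracies of F-relaxation, of $P$ as an approximation of ideal interpolation, and of $R$ as an approximation of ideal restriction are measured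 by $$\delta_F = I-\Delta_FA_{ff},\qquad \delta_P = A_{ff}W+A_{fc},\qquad \delta_R = ZA_{ff}+A_{cf},$$ respectively, and $$G = \delta_F + \Delta_F\delta_P\mathcal{K}^{-1} \delta_R .$$ WAP: for a symmetric positive definite matrix $\mathcal{A}\in\mathbb{R}^{n\times n}$, a matrix $Q\in\mathbb{R}^{n\times n_c}$ satisfies the weak approximation property with respect to $\mathcal{A}$, with constant $C$, if for every $\mathbf{v}\in\mathbb{R}^n$ there exists $\mathbf{w}_c\in\mathbb{R}^{n_c}$ such that $$\|\mathbf{v} - Q\mathbf{w}_c\|^2 \leq \frac{C}{\|\mathcal{A}\|} \langle \mathcal{A}\mathbf{v},\mathbf{v}\rangle .$$ *)

theory Defs
  imports "HOL-Analysis.Analysis"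
begin

text \<open>
  The index types \<open>'f\<close> and \<open>'c\<close> are the F-points and the C-points, and \<open>'f + 'c\<close> is the set of all
  unknowns. A matrix with rows indexed by \<open>'m\<close> and columns indexed by \<open>'n\<close> has type \<open>real^'n^'m\<close>.
\<close>

text \<open>
  The library's \<open>norm\<close> on \<open>real^'n^'m\<close> is the Frobenius norm, hence the explicit operator norm
  here. On vectors \<open>norm\<close> is the Euclidean norm.
\<close>

definition opnorm :: "real^'n^'m \<Rightarrow> real" where
  "opnorm M = onorm ((*v) M)"

definition blk_ff :: "real^('f::finite + 'c::finite)^('f + 'c) \<Rightarrow> real^'f^'f" where
  "blk_ff A = (\<chi> i j. A $ Inl i $ Inl j)"

definition blk_fc :: "real^('f::finite + 'c::finite)^('f + 'c) \<Rightarrow> real^'c^'f" where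
  "blk_fc A = (\<chi> i j. A $ Inl i $ Inr j)"

definition blk_cf :: "real^('f::finite + 'c::finite)^('f + 'c) \<Rightarrow> real^'f^'c" where
  "blk_cf A = (\<chi> i j. A $ Inr i $ Inl j)"

definition blk_cc :: "real^('f::finite + 'c::finite)^('f + 'c) \<Rightarrow> real^'c^'c" where
  "blk_cc A = (\<chi> i j. A $ Inr i $ Inr j)"

definition interp :: "real^'c^'f \<Rightarrow> real^'c^('f::finite + 'c::finite)" where
  "interp W = (\<chi> i j. case i of Inl k \<Rightarrow> W $ k $ j | Inr k \<Rightarrow> mat 1 $ k $ j)"

definition restr :: "real^'f^'c \<Rightarrow> real^('f::finite + 'c::finite)^'c" where
  "restr Z = (\<chi> i j. case j of Inl k \<Rightarrow> Z $ i $ k | Inr k \<Rightarrow> mat 1 $ i $ k)"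

definition coarse_op ::
  "real^('f::finite + 'c::finite)^('f + 'c) \<Rightarrow> real^'c^'f \<Rightarrow> real^'f^'c \<Rightarrow> real^'c^'c" where
  "coarse_op A W Z = restr Z ** A ** interp W"

definition admissible ::
  "real^('f::finite + 'c::finite)^('f + 'c) \<Rightarrow> real^'c^'f \<Rightarrow> real^'f^'c \<Rightarrow> real^'f^'f \<Rightarrow> bool" where
  "admissible A W Z D \<longleftrightarrow> invertible (coarse_op A W Z) \<and> invertible D"

definition delta_F ::
  "real^('f::finite + 'c::finite)^('f + 'c) \<Rightarrow> real^'f^'f \<Rightarrow> real^'f^'f" where
  "delta_F A D = mat 1 - D ** blk_ff A"

definition delta_P ::
  "real^('f::finite + 'c::finite)^('f + 'c) \<Rightarrow> real^'c^'f \<Rightarrow> real^'c^'f" where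
  "delta_P A W = blk_ff A ** W + blk_fc A"

definition delta_R ::
  "real^('f::finite + 'c::finite)^('f + 'c) \<Rightarrow> real^'f^'c \<Rightarrow> real^'f^'c" where
  "delta_R A Z = Z ** blk_ff A + blk_cf A"

definition G_mat ::
  "real^('f::finite + 'c::finite)^('f + 'c) \<Rightarrow> real^'c^'f \<Rightarrow> real^'f^'c \<Rightarrow> real^'f^'f \<Rightarrow> real^'f^'f" where
  "G_mat A W Z D =
     delta_F A D + D ** delta_P A W ** matrix_inv (coarse_op A W Z) ** delta_R A Z"

text \<open>
  The weak approximation property of \<open>Q\<close> with respect to \<open>M\<close>, with constant \<open>C\<close>. It is meant for
  symmetric positive definite \<open>M\<close>, which holds for \<open>transpose A ** A\<close> with \<open>A\<close> invertible.
\<close>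

definition weak_approx :: "real^'n^'n \<Rightarrow> real^'m^'n \<Rightarrow> real \<Rightarrow> bool" where
  "weak_approx M Q C \<longleftrightarrow>
     (\<forall>v. \<exists>w. (norm (v - Q *v w))\<^sup>2 \<le> C / opnorm M * ((M *v v) \<bullet> v))"

definition C_W :: "real^'c^'f \<Rightarrow> real \<Rightarrow> real" where
  "C_W W C = sqrt (C * (1 + (opnorm W)\<^sup>2))"

definition rho ::
  "real^('f::finite + 'c::finite)^('f + 'c) \<Rightarrow> real^'c^'f \<Rightarrow> real \<Rightarrow> real^'f^'c \<Rightarrow> real^'f^'f \<Rightarrow> real" where
  "rho A W C Z D = opnorm (delta_F A D) + (1 + opnorm (delta_F A D)) *
     (C_W W C * opnorm (delta_R A Z) / (opnorm A - C_W W C * opnorm (delta_R A Z)))"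

lemma sum_UNIV_Plus:
  fixes g :: "'f::finite + 'c::finite \<Rightarrow> real"
  shows "(\<Sum>k\<in>UNIV. g k) = (\<Sum>k\<in>UNIV. g (Inl k)) + (\<Sum>k\<in>UNIV. g (Inr k))"
  by (subst UNIV_Plus_UNIV [symmetric], subst sum.Plus) auto

lemma coarse_op_blocks:
  "coarse_op A W Z =
     Z ** blk_ff A ** W + blk_cf A ** W + Z ** blk_fc A + blk_cc A"
proof -
  have RA: "(restr Z ** A) $ i $ k = (case k of
      Inl l \<Rightarrow> (Z ** blk_ff A + blk_cf A) $ i $ l | Inr l \<Rightarrow> (Z ** blk_fc A + blk_cc A) $ i $ l)"
    for i k
    by (cases k) (simp_all add: matrix_matrix_mult_def restr_def blk_ff_def blk_cf_def blk_fc_def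
        blk_cc_def sum_UNIV_Plus mat_def if_distrib if_distribR cong: if_cong)
  have "coarse_op A W Z = (Z ** blk_ff A + blk_cf A) ** W + (Z ** blk_fc A + blk_cc A) ** mat 1"
    unfolding coarse_op_def
    by (subst vec_eq_iff, subst matrix_matrix_mult_def, subst (4) matrix_matrix_mult_def, 
        simp add: vec_eq_iff RA sum_UNIV_Plus interp_def)
       (simp add: matrix_matrix_mult_def)
  then show ?thesis
    by (simp add: vec_eq_iff matrix_matrix_mult_def sum.distrib algebra_simps mat_def if_distrib cong: if_cong)
qed

end

theory Submission imports Defs begin

text \<open>
  Let \<open>E = W + A\<^sub>f\<^sub>f\<^sup>-\<^sup>1A\<^sub>f\<^sub>c\<close> be the error of \<open>W\<close> against ideal interpolation and let \<open>S\<close> be the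
  Schur complement of \<open>A\<^sub>f\<^sub>f\<close> in \<open>A\<close>. Three facts carry the proof.

  First, \<open>A\<close> maps the ideally interpolated vector of \<open>q\<close> to \<open>(0, S q)\<close>. The weak approximation
  property at this vector has \<open>\<parallel>S q\<parallel>\<^sup>2\<close> on its right-hand side, and the approximation error on its left
  controls \<open>E q\<close>; this gives \<open>\<parallel>A\<parallel> \<parallel>E q\<parallel> \<le> C\<^sub>W \<parallel>S q\<parallel>\<close> (\<open>interpolation_error_le_schur\<close>).

  Second, \<open>\<K> = S + \<delta>\<^sub>R E\<close> (\<open>coarse_op_mult_vec\<close>). So \<open>\<K> q = \<delta>\<^sub>R u\<close> means
  \<open>S q = \<delta>\<^sub>R (u - E q)\<close>, and the first fact turns this into an inequality for \<open>\<parallel>E q\<parallel>\<close> that can be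
  solved as soon as \<open>C\<^sub>W \<parallel>\<delta>\<^sub>R\<parallel> < \<parallel>A\<parallel>\<close> (\<open>coarse_correction_error\<close>). The same inequality with
  \<open>u = 0\<close> shows that \<open>\<K>\<close> is nonsingular.

  Third, \<open>\<Delta>\<^sub>F \<delta>\<^sub>P = \<Delta>\<^sub>F A\<^sub>f\<^sub>f E = (I - \<delta>\<^sub>F) E\<close>. Hence \<open>G u = \<delta>\<^sub>F u + (I - \<delta>\<^sub>F) E q\<close> with
  \<open>q = \<K>\<^sup>-\<^sup>1 \<delta>\<^sub>R u\<close>, which is the bound \<open>\<rho>\<close>. Since \<open>\<delta>\<^sub>R\<close> and \<open>\<delta>\<^sub>F\<close> are linear in the deviations
  of \<open>Z\<close> and \<open>\<Delta>\<^sub>F\<close> from their ideal values, \<open>\<rho>\<close> tends to \<open>0\<close> with these deviations.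
\<close>

section \<open>Matrix algebra\<close>

lemma uminus_mult_vec: "(- M) *v x = - (M *v x)" for M :: "real^'n^'m"
  by (simp add: vec_eq_iff matrix_vector_mult_def sum_negf)

lemma mult_vec_uminus: "M *v (- x) = - (M *v x)" for M :: "real^'n^'m"
  by (simp add: vec_eq_iff matrix_vector_mult_def sum_negf)

lemma matrix_add_mult: "(L + M) ** N = L ** N + M ** N" for L M :: "real^'n^'m"
  by (simp add: vec_eq_iff matrix_matrix_mult_def distrib_right sum.distrib)

lemma matrix_diff_mult: "(L - M) ** N = L ** N - M ** N" for L M :: "real^'n^'m"
  by (simp add: vec_eq_iff matrix_matrix_mult_def left_diff_distrib sum_subtractf)

lemma matrix_inv_inverse:
  fixes M :: "real^'n^'n"
  assumes "invertible M"
  shows "M ** matrix_inv M = mat 1" "matrix_inv M ** M = mat 1"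
proof -
  have "\<exists>N. M ** N = mat 1 \<and> N ** M = mat 1"
    using assms by (simp add: invertible_def)
  then have "M ** matrix_inv M = mat 1 \<and> matrix_inv M ** M = mat 1"
    unfolding matrix_inv_def by (rule someI_ex)
  then show "M ** matrix_inv M = mat 1" "matrix_inv M ** M = mat 1" by auto
qed

lemma mult_vec_matrix_inv:
  fixes M :: "real^'n^'n"
  assumes "invertible M"
  shows "M *v (matrix_inv M *v x) = x"
  by (simp add: matrix_vector_mul_assoc matrix_inv_inverse(1)[OF assms])

section \<open>Operator norms\<close>

lemma norm_mult_vec_le_opnorm: "norm (M *v x) \<le> opnorm M * norm x"
  for M :: "real^'n^'m"
  unfolding opnorm_def by (rule onorm[OF matrix_vector_mul_bounded_linear])

lemma opnorm_nonneg: "0 \<le> opnorm M" for M :: "real^'n^'m"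
  unfolding opnorm_def by (rule onorm_pos_le[OF matrix_vector_mul_bounded_linear])

lemma opnorm_leI:
  fixes M :: "real^'n^'m"
  assumes "\<And>x. norm (M *v x) \<le> b * norm x"
  shows "opnorm M \<le> b"
  unfolding opnorm_def by (rule onorm_le) (rule assms)

lemma opnorm_mult_le: "opnorm (M ** N) \<le> opnorm M * opnorm N"
  for M :: "real^'n^'m" and N :: "real^'k^'n"
proof (rule opnorm_leI)
  fix x
  have "norm (M *v (N *v x)) \<le> opnorm M * (opnorm N * norm x)"
    by (rule order_trans[OF norm_mult_vec_le_opnorm mult_left_mono[OF norm_mult_vec_le_opnorm opnorm_nonneg]])
  then show "norm ((M ** N) *v x) \<le> opnorm M * opnorm N * norm x"
    by (simp add: matrix_vector_mul_assoc mult.assoc)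
qed

lemma opnorm_uminus: "opnorm (- M) = opnorm M" for M :: "real^'n^'m"
proof -
  have "((*v) (- M)) = (\<lambda>x. - (M *v x))"
    by (simp add: fun_eq_iff uminus_mult_vec)
  then show ?thesis
    by (simp add: opnorm_def onorm_neg)
qed

lemma opnorm_pos:
  fixes M :: "real^'n^'n"
  assumes "invertible M"
  shows "0 < opnorm M"
proof -
  have "M *v axis undefined 1 \<noteq> 0"
    using assms by (metis axis_eq_0_iff inj_matrix_vector_mult injD matrix_vector_mult_0_right zero_neq_one)
  moreover have "norm (M *v axis undefined 1) \<le> opnorm M"
    using norm_mult_vec_le_opnorm[of M "axis undefined 1"] by simp
  ultimately show ?thesis
    by (meson less_le_trans zero_less_norm_iff)
qed

lemma gram_inner: "((transpose M ** M) *v x) \<bullet> x = (norm (M *v x))\<^sup>2"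
  for M :: "real^'n^'m"
  by (simp add: matrix_vector_mul_assoc[symmetric] dot_lmul_matrix transpose_matrix_vector power2_norm_eq_inner)

text \<open>
  \<open>\<parallel>M x\<parallel>\<^sup>2\<close> is the inner product of \<open>M\<^sup>*M x\<close> and \<open>x\<close>, to which Cauchy-Schwarz applies. The weak
  approximation property is normalized by \<open>\<parallel>A\<^sup>*A\<parallel>\<close>; this is how \<open>\<parallel>A\<parallel>\<close> enters \<open>\<rho>\<close>.
\<close>

lemma opnorm_power2_le_gram: "(opnorm M)\<^sup>2 \<le> opnorm (transpose M ** M)"
  for M :: "real^'n^'m"
proof -
  let ?g = "opnorm (transpose M ** M)"
  have "opnorm M \<le> sqrt ?g"
  proof (rule opnorm_leI)
    fix x
    have "(norm (M *v x))\<^sup>2 \<le> norm ((transpose M ** M) *v x) * norm x"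
      by (metis gram_inner norm_cauchy_schwarz)
    also have "\<dots> \<le> (?g * norm x) * norm x"
      by (rule mult_right_mono[OF norm_mult_vec_le_opnorm]) simp
    also have "\<dots> = (sqrt ?g * norm x)\<^sup>2"
      by (simp add: power_mult_distrib opnorm_nonneg power2_eq_square[of "norm x"])
    finally have "(norm (M *v x))\<^sup>2 \<le> (sqrt ?g * norm x)\<^sup>2" .
    then show "norm (M *v x) \<le> sqrt ?g * norm x"
      by (rule power2_le_imp_le) (simp add: opnorm_nonneg)
  qed
  then show ?thesis
    using power_mono[OF _ opnorm_nonneg, of M "sqrt ?g" 2] by (simp add: opnorm_nonneg)
qed

lemma square_invertibleI:
  fixes M :: "real^'n^'n"
  assumes "\<And>x. M *v x = 0 \<Longrightarrow> x = 0"
  shows "invertible M"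
  using assms by (metis invertible_left_inverse matrix_left_invertible_ker)

lemma invertible_mult_vec_eq_0:
  fixes M :: "real^'n^'n"
  assumes "invertible M" "M *v x = 0"
  shows "x = 0"
  using assms by (metis invertible_left_inverse matrix_left_invertible_ker)

text \<open>
  A vector in the kernel of \<open>M N\<close> is fixed by \<open>I - M N\<close>, which shrinks every nonzero vector. For
  \<open>M = \<Delta>\<^sub>F\<close> and \<open>N = A\<^sub>f\<^sub>f\<close> the hypothesis reads \<open>\<parallel>\<delta>\<^sub>F\<parallel> < 1\<close>.
\<close>

lemma invertible_left_factor:
  fixes M N :: "real^'n^'n"
  assumes "opnorm (mat 1 - M ** N) < 1"
  shows "invertible M"
proof -
  have "invertible (M ** N)"
  proof (rule square_invertibleI)
    fix x assume "(M ** N) *v x = 0"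
    then have le: "norm x \<le> opnorm (mat 1 - M ** N) * norm x"
      using norm_mult_vec_le_opnorm[of "mat 1 - M ** N" x]
      by (simp add: matrix_vector_mult_diff_rdistrib)
    show "x = 0"
    proof (rule ccontr)
      assume "x \<noteq> 0"
      then have "opnorm (mat 1 - M ** N) * norm x < 1 * norm x"
        using assms by (intro mult_strict_right_mono) simp_all
      with le show False by simp
    qed
  qed
  then obtain L where "(M ** N) ** L = mat 1"
    unfolding invertible_def by blast
  then have "M ** (N ** L) = mat 1"
    by (simp only: matrix_mul_assoc)
  then show ?thesis
    unfolding invertible_right_inverse by blast
qed

section \<open>F- and C-components\<close>

definition f_part :: "real^('f::finite + 'c::finite) \<Rightarrow> real^'f" where
  "f_part x = (\<chi> i. x $ Inl i)"

definition c_part :: "real^('f::finite + 'c::finite) \<Rightarrow> real^'c" where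
  "c_part x = (\<chi> i. x $ Inr i)"

lemma norm_power2_parts: "(norm x)\<^sup>2 = (norm (f_part x))\<^sup>2 + (norm (c_part x))\<^sup>2"
  by (simp add: power2_norm_eq_inner inner_vec_def sum_UNIV_Plus f_part_def c_part_def)

lemma f_part_diff: "f_part (x - y) = f_part x - f_part y"
  by (simp add: f_part_def vec_eq_iff)

lemma c_part_diff: "c_part (x - y) = c_part x - c_part y"
  by (simp add: c_part_def vec_eq_iff)

lemma f_part_mult_vec: "f_part (A *v x) = blk_ff A *v f_part x + blk_fc A *v c_part x"
  by (simp add: vec_eq_iff f_part_def c_part_def blk_ff_def blk_fc_def matrix_vector_mult_def sum_UNIV_Plus)

lemma c_part_mult_vec: "c_part (A *v x) = blk_cf A *v f_part x + blk_cc A *v c_part x"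
  by (simp add: vec_eq_iff f_part_def c_part_def blk_cf_def blk_cc_def matrix_vector_mult_def sum_UNIV_Plus)

lemma f_part_interp: "f_part (interp W *v q) = W *v q"
  by (simp add: vec_eq_iff f_part_def interp_def matrix_vector_mult_def)

lemma c_part_interp: "c_part (interp W *v q) = q"
  by (simp add: vec_eq_iff c_part_def interp_def matrix_vector_mult_def mat_def
      if_distrib if_distribR cong: if_cong)

lemma restr_mult_vec: "restr Z *v x = Z *v f_part x + c_part x"
  by (simp add: vec_eq_iff f_part_def c_part_def restr_def matrix_vector_mult_def sum_UNIV_Plus
      mat_def if_distrib if_distribR cong: if_cong)

section \<open>Ideal interpolation and the Schur complement\<close>

definition ideal_weights :: "real^('f::finite + 'c::finite)^('f + 'c) \<Rightarrow> real^'c^'f" where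
  "ideal_weights A = - (matrix_inv (blk_ff A) ** blk_fc A)"

definition schur :: "real^('f::finite + 'c::finite)^('f + 'c) \<Rightarrow> real^'c^'c" where
  "schur A = blk_cf A ** ideal_weights A + blk_cc A"

lemma blk_ff_ideal_weights:
  assumes "invertible (blk_ff A)"
  shows "blk_ff A *v (ideal_weights A *v q) = - (blk_fc A *v q)"
proof -
  have "ideal_weights A *v q = - (matrix_inv (blk_ff A) *v (blk_fc A *v q))"
    by (simp add: ideal_weights_def uminus_mult_vec matrix_vector_mul_assoc)
  then show ?thesis
    using assms by (simp add: mult_vec_uminus mult_vec_matrix_inv)
qed

lemma f_part_ideal:
  assumes "invertible (blk_ff A)"
  shows "f_part (A *v (interp (ideal_weights A) *v q)) = 0"
  by (simp add: f_part_mult_vec f_part_interp c_part_interp blk_ff_ideal_weights[OF assms])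

lemma c_part_ideal: "c_part (A *v (interp (ideal_weights A) *v q)) = schur A *v q"
  by (simp add: c_part_mult_vec f_part_interp c_part_interp schur_def matrix_vector_mult_add_rdistrib
      matrix_vector_mul_assoc[symmetric])

lemma norm_ideal:
  assumes "invertible (blk_ff A)"
  shows "norm (A *v (interp (ideal_weights A) *v q)) = norm (schur A *v q)"
proof -
  have "(norm (A *v (interp (ideal_weights A) *v q)))\<^sup>2 = (norm (schur A *v q))\<^sup>2"
    by (simp add: norm_power2_parts f_part_ideal[OF assms] c_part_ideal)
  then show ?thesis by simp
qed

lemma schur_mult_vec_eq_0:
  assumes "invertible A" "invertible (blk_ff A)" "schur A *v q = 0"
  shows "q = 0"
proof -
  have "interp (ideal_weights A) *v q = 0"
    using assms norm_ideal[OF assms(2), of q] invertible_mult_vec_eq_0[OF assms(1)] by simp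
  then have "c_part (interp (ideal_weights A) *v q) = 0"
    by (simp add: c_part_def vec_eq_iff)
  then show ?thesis
    by (simp only: c_part_interp)
qed

lemma delta_P_mult_vec:
  assumes "invertible (blk_ff A)"
  shows "delta_P A W *v q = blk_ff A *v ((W - ideal_weights A) *v q)"
  by (simp add: delta_P_def matrix_vector_mult_add_rdistrib matrix_vector_mult_diff_rdistrib
      matrix_vector_mult_diff_distrib blk_ff_ideal_weights[OF assms] matrix_vector_mul_assoc[symmetric])

text \<open>
  With ideal weights, \<open>A\<close> followed by \<open>R\<close> gives \<open>S q\<close> for every \<open>Z\<close>, because the F-component on which
  \<open>Z\<close> acts vanishes. Changing the weights by \<open>E\<close> changes the fine-grid vector only in its F-component,
  by \<open>E q\<close>, and \<open>\<delta>\<^sub>R\<close> is \<open>R\<close> applied to the F-columns of \<open>A\<close>.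
\<close>

lemma coarse_op_mult_vec:
  assumes "invertible (blk_ff A)"
  shows "coarse_op A W Z *v q = schur A *v q + delta_R A Z *v ((W - ideal_weights A) *v q)"
proof -
  have f: "f_part (A *v (interp W *v q)) = blk_ff A *v ((W - ideal_weights A) *v q)"
    using delta_P_mult_vec[OF assms, of W q]
    by (simp add: f_part_mult_vec f_part_interp c_part_interp delta_P_def
        matrix_vector_mult_add_rdistrib matrix_vector_mul_assoc[symmetric])
  have c: "c_part (A *v (interp W *v q)) = blk_cf A *v ((W - ideal_weights A) *v q) + schur A *v q"
    by (simp add: c_part_mult_vec f_part_interp c_part_interp schur_def
        matrix_vector_mult_add_rdistrib matrix_vector_mult_diff_rdistrib
        matrix_vector_mult_diff_distrib matrix_vector_mul_assoc[symmetric])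
  have "coarse_op A W Z *v q = restr Z *v (A *v (interp W *v q))"
    by (simp add: coarse_op_def matrix_vector_mul_assoc[symmetric])
  then show ?thesis
    by (simp add: restr_mult_vec f c delta_R_def matrix_vector_mult_add_rdistrib
        matrix_vector_mul_assoc[symmetric])
qed

section \<open>Consequences of the weak approximation property\<close>

text \<open>A negative constant would make the right-hand side of the property negative at some vector.\<close>

lemma weak_approx_const_nonneg:
  fixes A :: "real^'n^'n" and Q :: "real^'m^'n"
  assumes "invertible A" "weak_approx (transpose A ** A) Q C"
  shows "0 \<le> C"
proof -
  let ?v = "axis undefined 1 :: real^'n"
  have "A *v ?v \<noteq> 0"
    using invertible_mult_vec_eq_0[OF assms(1)] by (metis axis_eq_0_iff zero_neq_one)
  moreover obtain w where
    "(norm (?v - Q *v w))\<^sup>2 \<le> C / opnorm (transpose A ** A) * (norm (A *v ?v))\<^sup>2"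
    using assms(2) unfolding weak_approx_def gram_inner by blast
  then have "0 \<le> C / opnorm (transpose A ** A) * (norm (A *v ?v))\<^sup>2"
    by (rule order_trans[OF zero_le_power2])
  moreover have "0 < opnorm (transpose A ** A)"
    using opnorm_power2_le_gram[of A] opnorm_pos[OF assms(1)] by (meson less_le_trans zero_less_power)
  ultimately show ?thesis
    by (simp add: zero_le_mult_iff zero_le_divide_iff)
qed

lemma weak_approx_gramE:
  fixes A :: "real^'n^'n" and Q :: "real^'m^'n"
  assumes "invertible A" "weak_approx (transpose A ** A) Q C"
  obtains w where "(opnorm A)\<^sup>2 * (norm (v - Q *v w))\<^sup>2 \<le> C * (norm (A *v v))\<^sup>2"
proof -
  let ?g = "opnorm (transpose A ** A)"
  obtain w where w: "(norm (v - Q *v w))\<^sup>2 \<le> C / ?g * (norm (A *v v))\<^sup>2"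
    using assms(2) unfolding weak_approx_def gram_inner by blast
  have "0 < ?g"
    using opnorm_power2_le_gram[of A] opnorm_pos[OF assms(1)] by (meson less_le_trans zero_less_power)
  have "(opnorm A)\<^sup>2 * (norm (v - Q *v w))\<^sup>2 \<le> ?g * (norm (v - Q *v w))\<^sup>2"
    by (rule mult_right_mono[OF opnorm_power2_le_gram]) simp
  also have "\<dots> \<le> C * (norm (A *v v))\<^sup>2"
    using w \<open>0 < ?g\<close> by (simp add: field_simps)
  finally show ?thesis by (rule that)
qed

lemma norm_mult_c_minus_f_le:
  fixes W :: "real^'c^'f"
  shows "(norm (W *v c_part e - f_part e))\<^sup>2 \<le> (1 + (opnorm W)\<^sup>2) * (norm e)\<^sup>2"
proof -
  let ?w = "opnorm W" and ?c = "norm (c_part e)" and ?f = "norm (f_part e)"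
  have "norm (W *v c_part e - f_part e) \<le> ?w * ?c + ?f"
    by (rule order_trans[OF norm_triangle_ineq4 add_right_mono[OF norm_mult_vec_le_opnorm]])
  then have "(norm (W *v c_part e - f_part e))\<^sup>2 \<le> (?w * ?c + ?f)\<^sup>2"
    by (rule power_mono) simp
  \<comment> \<open>The Cauchy-Schwarz inequality for the pairs \<open>(\<parallel>W\<parallel>, 1)\<close> and \<open>(\<parallel>c\<parallel>, \<parallel>f\<parallel>)\<close>.\<close>
  also have "\<dots> \<le> (1 + ?w\<^sup>2) * (?f\<^sup>2 + ?c\<^sup>2)"
    using zero_le_power2[of "?w * ?f - ?c"] by (simp add: power2_eq_square algebra_simps)
  finally show ?thesis
    by (simp add: norm_power2_parts[of e])
qed

text \<open>
  If \<open>w\<close> is the coarse vector that the property provides for the ideal interpolant of \<open>q\<close>, the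
  approximation error is \<open>(f, c) = (W\<^sub>i\<^sub>d\<^sub>e\<^sub>a\<^sub>l q - W w, q - w)\<close>. The unknown \<open>w\<close> cancels in
  \<open>W c - f = (W - W\<^sub>i\<^sub>d\<^sub>e\<^sub>a\<^sub>l) q\<close>; the cost of this combination is the factor \<open>1 + \<parallel>W\<parallel>\<^sup>2\<close> in \<open>C\<^sub>W\<close>.
\<close>

lemma interpolation_error_le_schur:
  assumes "invertible A" "invertible (blk_ff A)"
    and "weak_approx (transpose A ** A) (interp W) C"
  shows "opnorm A * norm ((W - ideal_weights A) *v q) \<le> C_W W C * norm (schur A *v q)"
proof -
  let ?v = "interp (ideal_weights A) *v q"
  obtain w where w: "(opnorm A)\<^sup>2 * (norm (?v - interp W *v w))\<^sup>2 \<le> C * (norm (A *v ?v))\<^sup>2"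
    by (rule weak_approx_gramE[OF assms(1,3), of ?v])
  define e where "e = ?v - interp W *v w"
  have "C \<ge> 0" by (rule weak_approx_const_nonneg[OF assms(1,3)])
  have "(W - ideal_weights A) *v q = W *v c_part e - f_part e"
    by (simp add: e_def c_part_diff f_part_diff c_part_interp f_part_interp
        matrix_vector_mult_diff_rdistrib matrix_vector_mult_diff_distrib)
  then have "(opnorm A * norm ((W - ideal_weights A) *v q))\<^sup>2
      = (opnorm A)\<^sup>2 * (norm (W *v c_part e - f_part e))\<^sup>2"
    by (simp add: power_mult_distrib)
  also have "\<dots> \<le> (opnorm A)\<^sup>2 * ((1 + (opnorm W)\<^sup>2) * (norm e)\<^sup>2)"
    by (rule mult_left_mono[OF norm_mult_c_minus_f_le]) simp
  also have "\<dots> = (1 + (opnorm W)\<^sup>2) * ((opnorm A)\<^sup>2 * (norm e)\<^sup>2)"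
    by (simp add: algebra_simps)
  also have "\<dots> \<le> (1 + (opnorm W)\<^sup>2) * (C * (norm (schur A *v q))\<^sup>2)"
    using w by (intro mult_left_mono) (simp_all add: e_def norm_ideal[OF assms(2)])
  also have "\<dots> = (C_W W C * norm (schur A *v q))\<^sup>2"
    using \<open>C \<ge> 0\<close> by (simp add: C_W_def power_mult_distrib add_nonneg_nonneg)
  finally show ?thesis
    by (rule power2_le_imp_le) (simp add: C_W_def \<open>C \<ge> 0\<close>)
qed

text \<open>
  \<open>S q = \<delta>\<^sub>R (u - E q)\<close> bounds \<open>\<parallel>A\<parallel> \<parallel>E q\<parallel>\<close> by \<open>C\<^sub>W \<parallel>\<delta>\<^sub>R\<parallel> (\<parallel>u\<parallel> + \<parallel>E q\<parallel>)\<close>, and the term in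
  \<open>\<parallel>E q\<parallel>\<close> is absorbed on the left. The conclusion is stated without division so that \<open>u = 0\<close> yields
  injectivity of \<open>\<K>\<close>, before \<open>\<K>\<^sup>-\<^sup>1\<close> is known to exist.
\<close>

lemma coarse_correction_error:
  assumes "invertible A" "invertible (blk_ff A)"
    and "weak_approx (transpose A ** A) (interp W) C"
    and "coarse_op A W Z *v q = delta_R A Z *v u"
  shows "(opnorm A - C_W W C * opnorm (delta_R A Z)) * norm ((W - ideal_weights A) *v q)
    \<le> C_W W C * opnorm (delta_R A Z) * norm u"
proof -
  let ?E = "(W - ideal_weights A) *v q" and ?d = "opnorm (delta_R A Z)"
  have "0 \<le> C_W W C"
    using weak_approx_const_nonneg[OF assms(1,3)] by (simp add: C_W_def)
  have "schur A *v q = delta_R A Z *v (u - ?E)"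
    using assms(4) unfolding coarse_op_mult_vec[OF assms(2)]
    by (simp add: matrix_vector_mult_diff_distrib algebra_simps)
  then have "norm (schur A *v q) \<le> ?d * norm (u - ?E)"
    by (simp add: norm_mult_vec_le_opnorm)
  also have "\<dots> \<le> ?d * (norm u + norm ?E)"
    by (rule mult_left_mono[OF norm_triangle_ineq4 opnorm_nonneg])
  finally have "C_W W C * norm (schur A *v q) \<le> C_W W C * (?d * (norm u + norm ?E))"
    using \<open>0 \<le> C_W W C\<close> by (rule mult_left_mono)
  with interpolation_error_le_schur[OF assms(1-3), of q] show ?thesis
    by (simp add: algebra_simps)
qed

lemma invertible_coarse_op:
  assumes "invertible A" "invertible (blk_ff A)"
    and "weak_approx (transpose A ** A) (interp W) C"
    and "C_W W C * opnorm (delta_R A Z) < opnorm A"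
  shows "invertible (coarse_op A W Z)"
proof (rule square_invertibleI)
  fix q assume K: "coarse_op A W Z *v q = 0"
  then have "(opnorm A - C_W W C * opnorm (delta_R A Z)) * norm ((W - ideal_weights A) *v q) \<le> 0"
    using coarse_correction_error[OF assms(1-3), of Z q 0] by simp
  with assms(4) have "(W - ideal_weights A) *v q = 0"
    by (simp add: mult_le_0_iff)
  with K have "schur A *v q = 0"
    by (simp add: coarse_op_mult_vec[OF assms(2)])
  then show "q = 0"
    by (rule schur_mult_vec_eq_0[OF assms(1,2)])
qed

section \<open>The error bound\<close>

lemma opnorm_G_mat_le_rho:
  assumes "invertible A" "invertible (blk_ff A)"
    and "weak_approx (transpose A ** A) (interp W) C"
    and "invertible (coarse_op A W Z)"
    and "C_W W C * opnorm (delta_R A Z) < opnorm A"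
  shows "opnorm (G_mat A W Z D) \<le> rho A W C Z D"
proof (rule opnorm_leI)
  fix u
  let ?t = "opnorm (delta_F A D)"
    and ?s = "C_W W C * opnorm (delta_R A Z) / (opnorm A - C_W W C * opnorm (delta_R A Z))"
  define q where "q = matrix_inv (coarse_op A W Z) *v (delta_R A Z *v u)"
  define x where "x = (W - ideal_weights A) *v q"
  have "coarse_op A W Z *v q = delta_R A Z *v u"
    using assms(4) by (simp add: q_def mult_vec_matrix_inv)
  from coarse_correction_error[OF assms(1-3) this] assms(5) have x: "norm x \<le> ?s * norm u"
    by (simp add: x_def field_simps)
  have "G_mat A W Z D *v u = delta_F A D *v u + D *v (delta_P A W *v q)"
    by (simp add: G_mat_def q_def matrix_vector_mult_add_rdistrib matrix_vector_mul_assoc[symmetric])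
  also have "D *v (delta_P A W *v q) = x - delta_F A D *v x"
    unfolding delta_P_mult_vec[OF assms(2)] x_def[symmetric]
    by (simp add: delta_F_def matrix_vector_mult_diff_rdistrib matrix_vector_mul_assoc[symmetric])
  finally have "norm (G_mat A W Z D *v u)
      \<le> norm (delta_F A D *v u) + (norm x + norm (delta_F A D *v x))"
    by (simp only:) (rule order_trans[OF norm_triangle_ineq add_left_mono[OF norm_triangle_ineq4]])
  also have "\<dots> \<le> ?t * norm u + (norm x + ?t * norm x)"
    by (intro add_mono norm_mult_vec_le_opnorm order_refl)
  also have "\<dots> = ?t * norm u + (1 + ?t) * norm x"
    by (simp add: algebra_simps)
  also have "\<dots> \<le> ?t * norm u + (1 + ?t) * (?s * norm u)"
    using x by (intro add_left_mono mult_left_mono) (simp_all add: opnorm_nonneg)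
  also have "\<dots> = rho A W C Z D * norm u"
    by (simp add: rho_def algebra_simps)
  finally show "norm (G_mat A W Z D *v u) \<le> rho A W C Z D * norm u" .
qed

text \<open>
  The thresholds give \<open>\<rho> < 1/4 + 5/4 \<cdot> 1/3 = 2/3\<close>: the second one makes the fraction in \<open>\<rho>\<close> less
  than \<open>1/3\<close>.
\<close>

lemma rho_less_1:
  assumes "opnorm (delta_F A D) < 1 / 4"
    and "4 * (C_W W C * opnorm (delta_R A Z)) < opnorm A" "0 < opnorm A"
  shows "rho A W C Z D < 1"
proof -
  let ?t = "opnorm (delta_F A D)" and ?d = "C_W W C * opnorm (delta_R A Z)"
  have "?d / (opnorm A - ?d) < 1 / 3"
    using assms(2,3) by (simp add: field_simps)
  then have "rho A W C Z D \<le> ?t + (1 + ?t) * (1 / 3)"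
    unfolding rho_def by (intro add_left_mono mult_left_mono) (simp_all add: opnorm_nonneg)
  also have "\<dots> < 1"
    using assms(1) by (simp add: field_simps)
  finally show ?thesis .
qed

text \<open>
  \<open>\<delta>\<^sub>R\<close> and \<open>\<delta>\<^sub>F\<close> are, up to sign, the deviations of \<open>Z\<close> and \<open>\<Delta>\<^sub>F\<close> from the matrices that they
  approximate, multiplied by \<open>A\<^sub>f\<^sub>f\<close> on the right.
\<close>

lemma opnorm_delta_R_le:
  assumes "invertible (blk_ff A)"
  shows "opnorm (delta_R A Z)
    \<le> opnorm (Z - (- (blk_cf A ** matrix_inv (blk_ff A)))) * opnorm (blk_ff A)"
proof -
  have "delta_R A Z = (Z - (- (blk_cf A ** matrix_inv (blk_ff A)))) ** blk_ff A"
    using assms by (simp add: delta_R_def matrix_add_mult matrix_mul_assoc[symmetric] matrix_inv_inverse)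
  then show ?thesis by (simp only: opnorm_mult_le)
qed

lemma opnorm_delta_F_le:
  assumes "invertible (blk_ff A)"
  shows "opnorm (delta_F A D) \<le> opnorm (D - matrix_inv (blk_ff A)) * opnorm (blk_ff A)"
proof -
  have "delta_F A D = - ((D - matrix_inv (blk_ff A)) ** blk_ff A)"
    using assms by (simp add: delta_F_def matrix_diff_mult matrix_inv_inverse)
  then show ?thesis by (simp only: opnorm_uminus opnorm_mult_le)
qed

theorem theorem3p5:
  fixes A :: "real^('f::finite + 'c::finite)^('f + 'c)"
    and W :: "real^'c^'f"
    and C_P :: real
  assumes "invertible A"
    and "invertible (blk_ff A)"
    and "weak_approx (transpose A ** A) (interp W) C_P"
  shows
    "(\<forall>(Z :: real^'f^'c) (D :: real^'f^'f).
        admissible A W Z D \<longrightarrow> C_W W C_P * opnorm (delta_R A Z) < opnorm A \<longrightarrow>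
        opnorm (G_mat A W Z D) \<le> rho A W C_P Z D) \<and>
     (\<exists>\<epsilon>>0. \<forall>(Z :: real^'f^'c) (D :: real^'f^'f).
        opnorm (Z - (- (blk_cf A ** matrix_inv (blk_ff A)))) < \<epsilon> \<longrightarrow>
        opnorm (D - matrix_inv (blk_ff A)) < \<epsilon> \<longrightarrow>
          admissible A W Z D \<and>
          C_W W C_P * opnorm (delta_R A Z) < opnorm A \<and>
          opnorm (G_mat A W Z D) \<le> rho A W C_P Z D \<and>
          rho A W C_P Z D < 1)"
proof (intro conjI allI impI)
  fix Z :: "real^'f^'c" and D :: "real^'f^'f"
  assume "admissible A W Z D" "C_W W C_P * opnorm (delta_R A Z) < opnorm A"
  then show "opnorm (G_mat A W Z D) \<le> rho A W C_P Z D"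
    unfolding admissible_def by (intro opnorm_G_mat_le_rho[OF assms]) auto
next
  let ?a = "opnorm A" and ?f = "opnorm (blk_ff A)" and ?c = "C_W W C_P"
  have a: "0 < ?a" and f: "0 < ?f"
    using assms(1,2) by (auto intro: opnorm_pos)
  have c: "0 \<le> ?c"
    using weak_approx_const_nonneg[OF assms(1,3)] by (simp add: C_W_def)
  \<comment> \<open>The two arguments of the minimum give \<open>\<parallel>\<delta>\<^sub>F\<parallel> < 1/4\<close> and \<open>4 C\<^sub>W \<parallel>\<delta>\<^sub>R\<parallel> < \<parallel>A\<parallel>\<close>; \<open>C\<^sub>W\<close> may be small or zero,
    so \<open>C\<^sub>W + 1\<close> stands in the denominator.\<close>
  define \<epsilon> where "\<epsilon> = min (1 / (4 * ?f)) (?a / (4 * (?c + 1) * ?f))"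
  show "\<exists>\<epsilon>>0. \<forall>Z D.
        opnorm (Z - (- (blk_cf A ** matrix_inv (blk_ff A)))) < \<epsilon> \<longrightarrow>
        opnorm (D - matrix_inv (blk_ff A)) < \<epsilon> \<longrightarrow>
          admissible A W Z D \<and> ?c * opnorm (delta_R A Z) < ?a \<and>
          opnorm (G_mat A W Z D) \<le> rho A W C_P Z D \<and> rho A W C_P Z D < 1"
  proof (intro exI[of _ \<epsilon>] conjI[of "0 < \<epsilon>"] allI impI)
    show "0 < \<epsilon>" using a c f by (simp add: \<epsilon>_def)
  next
    fix Z :: "real^'f^'c" and D :: "real^'f^'f"
    assume Z: "opnorm (Z - (- (blk_cf A ** matrix_inv (blk_ff A)))) < \<epsilon>"
      and D: "opnorm (D - matrix_inv (blk_ff A)) < \<epsilon>"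
    have "opnorm (delta_F A D) < \<epsilon> * ?f"
      using opnorm_delta_F_le[OF assms(2), of D] mult_strict_right_mono[OF D f] by simp
    also have "\<dots> \<le> 1 / (4 * ?f) * ?f"
      using f by (intro mult_right_mono) (auto simp: \<epsilon>_def)
    finally have dF: "opnorm (delta_F A D) < 1 / 4"
      using f by simp
    have "opnorm (delta_R A Z) < \<epsilon> * ?f"
      using opnorm_delta_R_le[OF assms(2), of Z] mult_strict_right_mono[OF Z f] by simp
    also have "\<dots> \<le> ?a / (4 * (?c + 1) * ?f) * ?f"
      using f by (intro mult_right_mono) (auto simp: \<epsilon>_def)
    finally have "opnorm (delta_R A Z) < ?a / (4 * (?c + 1))"
      using f by simp
    then have "4 * (?c + 1) * opnorm (delta_R A Z) < ?a"
      using c by (simp add: field_simps)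
    then have dR: "4 * (?c * opnorm (delta_R A Z)) < ?a"
      using opnorm_nonneg[of "delta_R A Z"] by (simp add: algebra_simps)
    then have small: "?c * opnorm (delta_R A Z) < ?a"
      using a by linarith
    note K = invertible_coarse_op[OF assms small]
    have "invertible D"
      by (rule invertible_left_factor[of _ "blk_ff A"]) (use dF in \<open>simp add: delta_F_def\<close>)
    then show "admissible A W Z D \<and> ?c * opnorm (delta_R A Z) < ?a \<and>
        opnorm (G_mat A W Z D) \<le> rho A W C_P Z D \<and> rho A W C_P Z D < 1"
      using K small opnorm_G_mat_le_rho[OF assms K small] rho_less_1[OF dF dR a]
      by (simp add: admissible_def)
  qed
qed

end
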